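(* Let $\gamma$ be the Euler–Mascheroni constant. For $1\le k\le 8$ and integers $n\ge1$ define the finite continued fraction $$\mathrm{MC}_k(n)=\cfrac{a_1}{n+b_1+\cfrac{a_2}{n+b_2+\cfrac{a_3}{\ddots+\cfrac{a_k}{n+b_k}}}},$$ (so $\mathrm{MC}_1(n)=\frac{a_1}{n+b_1}$), where $a_1=\frac12,\ b_1=\frac16$; $a_2=\frac1{36},\ b_2=\frac{13}{30}$; $a_3=\frac{9}{25},\ b_3=\frac{17}{630}$; $a_4=\frac{6241}{15876},\ b_4=\frac{417941}{786366}$; $a_5=\frac{52272900}{38950081},\ b_5=-\frac{1835967509}{23923912386}$; $a_6=\frac{17194548650161}{14694541555716},\ b_6=\frac{431312596940299603}{686480136010816290}$; $a_7=\frac{93778512198179213368089}{32070070056327569608225},\ b_7=-\frac{75178865368857369613934863}{437108607837436422694763190}$; $a_8=\frac{14093175882028689333655328914081}{5957702453097198927838844740836},\ b_8=\frac{152838545298199920648591716358691154137}{212256305311307139071033336233757302422}$. Let $E_k(n)=\sum_{m=1}^{n}\frac1m-\ln n-\gamma-\mathrm{MC}_k(n)$. Then for every $k\in\{1,\dots,8\}$, $$\lim_{n\to\infty}n^{2k+2}\bigl(E_k(n)-E_k(n+1)\bigr)=(2k+1)C_k,\qquad \lim_{n\to\infty}n^{2k+1}E_k(n)=C_k,$$ where $C_1=-\frac1{72}$, $C_2=\frac1{200}$, $C_3=-\frac{6241}{3175200}$, $C_4=\frac{58081}{22018248}$, $C_5=-\frac{2755095121}{892586949408}$, $C_6=\frac{406806753641401}{45071152103463200}$,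 $C_7=-\frac{5115313723510706087761}{239581189590134660611200}$, $C_8=\frac{26329150006913625404731665769}{241842252367746831359300280968}$.
   Context: $\gamma=\lim_{n\to\infty}\left(\sum_{m=1}^n\frac1m-\ln n\right)$ is the Euler–Mascheroni constant. *)

theory Defs
  imports "HOL-Analysis.Analysis"
begin

text \<open>The finite continued fraction
  \<open>a1 / (x + b1 + a2 / (x + b2 + ... + ak / (x + bk)))\<close>
  given by the list \<open>[(a1, b1), ..., (ak, bk)]\<close>.\<close>

fun cfrac :: "(real \<times> real) list \<Rightarrow> real \<Rightarrow> real" where
  "cfrac [] x = 0"
| "cfrac ((a, b) # cs) x = a / (x + b + cfrac cs x)"

definition MC_coeffs :: "(real \<times> real) list" where
  "MC_coeffs =
    [(1 / 2, 1 / 6),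
     (1 / 36, 13 / 30),
     (9 / 25, 17 / 630),
     (6241 / 15876, 417941 / 786366),
     (52272900 / 38950081, - 1835967509 / 23923912386),
     (17194548650161 / 14694541555716, 431312596940299603 / 686480136010816290),
     (93778512198179213368089 / 32070070056327569608225, - 75178865368857369613934863 / 437108607837436422694763190),
     (14093175882028689333655328914081 / 5957702453097198927838844740836, 152838545298199920648591716358691154137 / 212256305311307139071033336233757302422)]"

definition MC :: "nat \<Rightarrow> nat \<Rightarrow> real" where
  "MC k n = cfrac (take k MC_coeffs) (real n)"

definition E :: "nat \<Rightarrow> nat \<Rightarrow> real" where
  "E k n = (\<Sum>m=1..n. 1 / real m) - ln (real n) - euler_mascheroni - MC k n"

text \<open>The list is indexed from \<open>0\<close>, the constants \<open>C 1, ..., C 8\<close> from \<open>1\<close>.\<close>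

definition C :: "nat \<Rightarrow> real" where
  "C k =
    [- 1 / 72,
     1 / 200,
     - 6241 / 3175200,
     58081 / 22018248,
     - 2755095121 / 892586949408,
     406806753641401 / 45071152103463200,
     - 5115313723510706087761 / 239581189590134660611200,
     26329150006913625404731665769 / 241842252367746831359300280968] ! (k - 1)"

end

theory Submission
  imports Defs "HOL-Computational_Algebra.Polynomial"
begin

text \<open>In the variable \<open>y = 1 / n\<close> the continued fraction is a quotient \<open>N / D\<close> of polynomials with
  \<open>D(0) = 1\<close>. Let \<open>P\<close> be the asymptotic expansion of the harmonic numbers minus \<open>ln n + \<gamma>\<close>, truncated
  after \<open>y\<^sup>1\<^sup>7\<close>. Then \<open>P - N / D = y ^ (2 k + 1) R(y)\<close> with \<open>R\<close> differentiable at \<open>0\<close> and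
  \<open>R(0) = C k\<close>, which is a finite computation with coefficients. The error of \<open>P\<close> itself is only
  controlled through its consecutive differences, where the harmonic numbers disappear and a Taylor
  expansion of \<open>ln (1 + y)\<close> suffices. This gives the first limit; the second follows from it by a
  Stolz--Cesaro argument, as \<open>E k\<close> tends to \<open>0\<close>.\<close>

section \<open>A Stolz-Cesaro argument for null sequences\<close>

text \<open>For \<open>u n = n / (n + 1)\<close> one has \<open>n * (1 - u n) = u n\<close>, so
  factoring \<open>1 - u n ^ p\<close> as a geometric sum leaves \<open>u n\<close> times
  \<open>p\<close> powers of \<open>u n\<close>, each tending to 1.\<close>

lemma tendsto_power_diff_inverse_power:
  "(\<lambda>n. real n ^ Suc p * ((1 / real n) ^ p - (1 / real (Suc n)) ^ p)) \<longlonglongrightarrow> real p"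
proof -
  define u where "u = (\<lambda>n. real n / real (Suc n))"
  have u: "u \<longlonglongrightarrow> 1"
    unfolding u_def by (rule LIMSEQ_n_over_Suc_n)
  have "(\<lambda>n. u n * (\<Sum>i<p. u n ^ i)) \<longlonglongrightarrow> 1 * (\<Sum>i<p. 1 ^ i)"
    by (intro tendsto_intros u)
  moreover have "\<forall>\<^sub>F n in sequentially. u n * (\<Sum>i<p. u n ^ i) =
      real n ^ Suc p * ((1 / real n) ^ p - (1 / real (Suc n)) ^ p)"
    using eventually_gt_at_top[of 0]
  proof eventually_elim
    case (elim n)
    have "u n * (\<Sum>i<p. u n ^ i) = real n * ((1 - u n) * (\<Sum>i<p. u n ^ i))"
      by (simp add: u_def field_simps)
    also have "\<dots> = real n * (1 - u n ^ p)"
      by (simp only: one_diff_power_eq)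
    also have "\<dots> = real n ^ Suc p * ((1 / real n) ^ p - (1 / real (Suc n)) ^ p)"
      using elim by (simp add: u_def power_divide right_diff_distrib)
    finally show ?case .
  qed
  ultimately show ?thesis
    by (auto dest: Lim_transform_eventually)
qed

lemma tendsto_zero_eventually_incseq_nonpos:
  fixes e :: "nat \<Rightarrow> real"
  assumes "e \<longlonglongrightarrow> 0" and "\<forall>\<^sub>F n in sequentially. e n \<le> e (Suc n)"
  shows "\<forall>\<^sub>F n in sequentially. e n \<le> 0"
proof -
  obtain N where N: "\<And>n. n \<ge> N \<Longrightarrow> e n \<le> e (Suc n)"
    using assms(2) by (auto simp: eventually_sequentially)
  have "incseq (\<lambda>m. e (m + N))"
    by (rule incseq_SucI) (use N in auto)
  moreover have "(\<lambda>m. e (m + N)) \<longlonglongrightarrow> 0"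
    using assms(1) by (rule LIMSEQ_ignore_initial_segment)
  ultimately have "e (m + N) \<le> 0" for m
    by (rule incseq_le)
  then show ?thesis
    unfolding eventually_sequentially by (metis le_add_diff_inverse2)
qed

text \<open>Subtracting \<open>M / n ^ p\<close> from \<open>e\<close> shifts the limit of the
  scaled differences to \<open>p * (L - M) < 0\<close>. The new sequence eventually increases to 0,
  hence is eventually nonpositive.\<close>

lemma eventually_power_times_le_of_diff:
  fixes e :: "nat \<Rightarrow> real"
  assumes "0 < p" and "e \<longlonglongrightarrow> 0"
    and "(\<lambda>n. real n ^ Suc p * (e n - e (Suc n))) \<longlonglongrightarrow> real p * L" and "L < M"
  shows "\<forall>\<^sub>F n in sequentially. real n ^ p * e n \<le> M"
proof -
  define d where "d = (\<lambda>n. e n - M * (1 / real n) ^ p)"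
  have "d \<longlonglongrightarrow> 0 - M * 0"
    unfolding d_def by (intro tendsto_intros assms tendsto_null_power lim_1_over_n)
  moreover have "\<forall>\<^sub>F n in sequentially. d n \<le> d (Suc n)"
  proof -
    have "(\<lambda>n. real n ^ Suc p * (e n - e (Suc n))
        - M * (real n ^ Suc p * ((1 / real n) ^ p - (1 / real (Suc n)) ^ p)))
      \<longlonglongrightarrow> real p * L - M * real p"
      by (intro tendsto_intros assms tendsto_power_diff_inverse_power)
    then have "(\<lambda>n. real n ^ Suc p * (d n - d (Suc n))) \<longlonglongrightarrow> real p * L - M * real p"
      by (simp add: d_def algebra_simps)
    moreover have "real p * L - M * real p < 0"
      using assms by (simp add: mult.commute)
    ultimately have "\<forall>\<^sub>F n in sequentially. real n ^ Suc p * (d n - d (Suc n)) < 0"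
      by (rule order_tendstoD)
    then show ?thesis
      by eventually_elim (auto simp: mult_less_0_iff)
  qed
  ultimately have "\<forall>\<^sub>F n in sequentially. d n \<le> 0"
    by (intro tendsto_zero_eventually_incseq_nonpos) auto
  then show ?thesis
    using eventually_gt_at_top[of 0]
    by eventually_elim (auto simp: d_def field_simps)
qed

text \<open>The one-sided bound, applied to \<open>e\<close> and to \<open>- e\<close>, squeezes the
  sequence from both sides.\<close>

lemma tendsto_power_times_of_diff:
  fixes e :: "nat \<Rightarrow> real"
  assumes "0 < p" and "e \<longlonglongrightarrow> 0"
    and "(\<lambda>n. real n ^ Suc p * (e n - e (Suc n))) \<longlonglongrightarrow> real p * L"
  shows "(\<lambda>n. real n ^ p * e n) \<longlonglongrightarrow> L"
proof (rule order_tendstoI)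
  fix a assume "L < a"
  then obtain M where M: "L < M" "M < a"
    using dense by blast
  show "\<forall>\<^sub>F n in sequentially. real n ^ p * e n < a"
    using eventually_power_times_le_of_diff[OF assms M(1)] by eventually_elim (use M in auto)
next
  fix a assume "a < L"
  then obtain M where M: "a < M" "M < L"
    using dense by blast
  have "(\<lambda>n. - e n) \<longlonglongrightarrow> 0"
    using tendsto_minus[OF assms(2)] by simp
  moreover have "(\<lambda>n. real n ^ Suc p * (- e n - - e (Suc n))) \<longlonglongrightarrow> real p * - L"
    using tendsto_minus[OF assms(3)] by (simp add: algebra_simps)
  ultimately have "\<forall>\<^sub>F n in sequentially. real n ^ p * - e n \<le> - M"
    by (rule eventually_power_times_le_of_diff[OF assms(1)]) (use M in auto)
  then show "\<forall>\<^sub>F n in sequentially. a < real n ^ p * e n"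
    by eventually_elim (use M in auto)
qed

section \<open>Local expansions at 0\<close>

lemma filterlim_inverse_nat_at_0: "filterlim (\<lambda>n. 1 / real n) (at 0) sequentially"
  by (auto simp: filterlim_at lim_1_over_n intro: eventually_mono[OF eventually_gt_at_top[of 0]])

text \<open>Discrete product rule: the difference of the powers gives the limit. The difference of
  the \<open>R\<close>-values contributes 0, since the scaled difference quotients
  \<open>s n\<close> and \<open>s (Suc n)\<close> both tend to \<open>R'\<close> and cancel.\<close>

lemma tendsto_power_times_diff_of_differentiable:
  fixes R :: "real \<Rightarrow> real"
  assumes "(R has_real_derivative R') (at 0)"
  shows "(\<lambda>n. real n ^ Suc p *
      ((1 / real n) ^ p * R (1 / real n) - (1 / real (Suc n)) ^ p * R (1 / real (Suc n))))
    \<longlonglongrightarrow> real p * R 0"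
proof -
  define u where "u = (\<lambda>n. real n / real (Suc n))"
  have u: "u \<longlonglongrightarrow> 1"
    unfolding u_def by (rule LIMSEQ_n_over_Suc_n)
  define s where "s = (\<lambda>n. real n * (R (1 / real n) - R 0))"
  have s: "s \<longlonglongrightarrow> R'"
    using filterlim_compose[OF assms[unfolded DERIV_def] filterlim_inverse_nat_at_0]
    by (simp add: s_def mult.commute)
  have R: "(\<lambda>n. R (1 / real n)) \<longlonglongrightarrow> R 0"
    using isCont_tendsto_compose[OF DERIV_isCont[OF assms] lim_1_over_n] .
  have "(\<lambda>n. real n ^ Suc p * ((1 / real n) ^ p - (1 / real (Suc n)) ^ p) * R (1 / real n)
      + u n ^ p * (s n - u n * s (Suc n))) \<longlonglongrightarrow> real p * R 0 + 1 ^ p * (R' - 1 * R')"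
    by (intro tendsto_intros tendsto_power_diff_inverse_power R u s LIMSEQ_Suc[OF s])
  moreover have "\<forall>\<^sub>F n in sequentially.
      real n ^ Suc p * ((1 / real n) ^ p - (1 / real (Suc n)) ^ p) * R (1 / real n)
        + u n ^ p * (s n - u n * s (Suc n)) =
      real n ^ Suc p *
        ((1 / real n) ^ p * R (1 / real n) - (1 / real (Suc n)) ^ p * R (1 / real (Suc n)))"
    using eventually_gt_at_top[of 0]
  proof eventually_elim
    case (elim n)
    have "s n - u n * s (Suc n) = real n * (R (1 / real n) - R (1 / real (Suc n)))"
      by (simp add: s_def u_def field_simps)
    moreover have "u n ^ p = real n ^ p * (1 / real (Suc n)) ^ p"
      by (simp add: u_def power_divide)
    ultimately show ?case
      by (simp only: power_Suc) (simp only: algebra_simps)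
  qed
  ultimately show ?thesis
    by (auto dest: Lim_transform_eventually)
qed

text \<open>A geometric sum collapses the derivative of the remainder to
  \<open>(- t) ^ m / (1 + t)\<close>; the mean value theorem then bounds the remainder.\<close>

lemma ln_one_plus_taylor_bound:
  fixes y :: real
  assumes "0 \<le> y"
  shows "\<bar>ln (1 + y) - (\<Sum>i<m. (- 1) ^ i / real (Suc i) * y ^ Suc i)\<bar> \<le> y ^ Suc m"
proof (cases "y = 0")
  case False
  define f where "f = (\<lambda>y. ln (1 + y) - (\<Sum>i<m. (- 1) ^ i / real (Suc i) * y ^ Suc i))"
  have deriv: "(f has_real_derivative (- t) ^ m / (1 + t)) (at t)" if "0 \<le> t" for t
  proof -
    have "(f has_real_derivative 1 / (1 + t) - (\<Sum>i<m. (- 1) ^ i / real (Suc i) * (real (Suc i) * t ^ i))) (at t)"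
      unfolding f_def using that by (auto intro!: derivative_eq_intros sum.cong simp del: power_Suc)
    also have "(\<Sum>i<m. (- 1) ^ i / real (Suc i) * (real (Suc i) * t ^ i)) = (\<Sum>i<m. (- t) ^ i)"
      by (intro sum.cong refl) (simp add: power_mult_distrib[symmetric] del: of_nat_Suc)
    also have "\<dots> = (1 - (- t) ^ m) / (1 + t)"
      using one_diff_power_eq[of "- t" m] that by (simp add: field_simps)
    finally show ?thesis
      by (simp add: diff_divide_distrib)
  qed
  obtain t where t: "0 < t" "t < y" "f y - f 0 = (y - 0) * ((- t) ^ m / (1 + t))"
    using MVT2[of 0 y f "\<lambda>t. (- t) ^ m / (1 + t)"] deriv assms False by force
  have "\<bar>f y\<bar> = y * (t ^ m / (1 + t))"
    using t assms by (simp add: f_def abs_mult power_abs)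
  also have "\<dots> \<le> y * (y ^ m / 1)"
    using t by (intro mult_left_mono frac_le power_mono) auto
  finally show ?thesis
    by (simp add: f_def)
qed auto

section \<open>Continued fractions as quotients of polynomials\<close>

text \<open>Stated by coefficients so that rewriting can check it one \<open>pCons\<close> at a
  time. The value \<open>c = 0\<close> is allowed and then gives one more order of
  vanishing.\<close>

definition lowest_term :: "nat \<Rightarrow> 'a::zero \<Rightarrow> 'a poly \<Rightarrow> bool" where
  "lowest_term p c q \<longleftrightarrow> (\<forall>i<p. coeff q i = 0) \<and> coeff q p = c"

lemma lowest_term_pCons:
  "lowest_term 0 c (pCons a q) \<longleftrightarrow> a = c"
  "lowest_term (Suc p) c (pCons a q) \<longleftrightarrow> a = 0 \<and> lowest_term p c q"
  by (auto simp: lowest_term_def less_Suc_eq_0_disj)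

lemma lowest_termE:
  fixes q :: "'a::comm_ring_1 poly"
  assumes "lowest_term p c q"
  obtains Q where "q = monom 1 p * Q" and "poly Q 0 = c"
proof -
  have "monom 1 p dvd q"
    using assms by (simp add: lowest_term_def monom_1_dvd_iff')
  then obtain Q where Q: "q = monom 1 p * Q"
    by (rule dvdE)
  then have "poly Q 0 = c"
    using assms by (simp add: lowest_term_def coeff_monom_mult poly_0_coeff_0)
  with Q show thesis
    by (rule that)
qed

text \<open>Numerator and denominator in \<open>y = 1 / x\<close>, from
  \<open>a / (1 / y + b + N / D) = a y D / (D + y (b D + N))\<close>.\<close>

fun cfrac_poly :: "(real \<times> real) list \<Rightarrow> real poly \<times> real poly" where
  "cfrac_poly [] = (0, [:1:])"
| "cfrac_poly ((a, b) # cs) =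
    (case cfrac_poly cs of (N, D) \<Rightarrow> (pCons 0 (smult a D), D + pCons 0 (smult b D + N)))"

lemma poly_snd_cfrac_poly_0: "poly (snd (cfrac_poly cs)) 0 = 1"
  by (induction cs rule: cfrac_poly.induct) (auto split: prod.split)

lemma eventually_poly_nonzero:
  assumes "poly D (0::real) \<noteq> 0"
  shows "\<forall>\<^sub>F n in sequentially. poly D (1 / real n) \<noteq> 0"
proof -
  have "(\<lambda>n. poly D (1 / real n)) \<longlonglongrightarrow> poly D 0"
    by (intro tendsto_intros lim_1_over_n)
  then show ?thesis
    using assms by (rule tendsto_imp_eventually_ne)
qed

lemma cfrac_eq_cfrac_poly:
  "\<forall>\<^sub>F n in sequentially. cfrac cs (real n) =
    poly (fst (cfrac_poly cs)) (1 / real n) / poly (snd (cfrac_poly cs)) (1 / real n)"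
proof (induction cs rule: cfrac_poly.induct)
  case (2 a b cs)
  obtain N D where ND: "cfrac_poly cs = (N, D)"
    by (cases "cfrac_poly cs")
  have "\<forall>\<^sub>F n in sequentially. poly D (1 / real n) \<noteq> 0"
    using poly_snd_cfrac_poly_0[of cs] by (intro eventually_poly_nonzero) (simp add: ND)
  with 2 show ?case
    using eventually_gt_at_top[of 0]
  proof eventually_elim
    case (elim n)
    have "real n + b + poly N (1 / real n) / poly D (1 / real n) =
        (poly D (1 / real n) + 1 / real n * (b * poly D (1 / real n) + poly N (1 / real n)))
          / (1 / real n * poly D (1 / real n))"
      using elim by (simp add: field_simps)
    \<comment> \<open>If the new denominator vanishes at \<open>1 / n\<close>, both sides are 0 by
      the convention for division by 0.\<close>
    with elim show ?case
      by (simp add: ND)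
  qed
qed simp

section \<open>The asymptotic expansion of the harmonic numbers\<close>

text \<open>The polynomial \<open>y / 2 - (\<Sum>j = 1..8. B\<^bsub>2j\<^esub> / (2 j) * y ^ (2 j))\<close> with the Bernoulli
  numbers \<open>B\<^bsub>2j\<^esub>\<close>, that is, the asymptotic expansion of the harmonic
  numbers minus \<open>ln n + \<gamma>\<close> in \<open>y = 1 / n\<close>.\<close>

definition harm_coeffs :: "real list" where
  "harm_coeffs = [0, 1 / 2, - 1 / 12, 0, 1 / 120, 0, - 1 / 252, 0, 1 / 240, 0, - 1 / 132, 0,
     691 / 32760, 0, - 1 / 12, 0, 3617 / 8160]"

text \<open>Substitutes \<open>y / (1 + y)\<close>, which turns \<open>1 / n\<close> into \<open>1 / (n + 1)\<close>, and clears denominators.\<close>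

fun subst_poly :: "real list \<Rightarrow> real poly" where
  "subst_poly [] = 0"
| "subst_poly (a # as) = smult a ([:1, 1:] ^ Suc (length as)) + pCons 0 (subst_poly as)"

lemma poly_subst_poly:
  assumes "1 + y \<noteq> 0"
  shows "poly (subst_poly as) y = (1 + y) ^ length as * poly (Poly as) (y / (1 + y))"
proof (induction as)
  case (Cons a as)
  have "y * (1 + y) ^ length as = (1 + y) ^ Suc (length as) * (y / (1 + y))"
    using assms by simp
  with Cons show ?case
    by (simp add: distrib_left del: power_Suc times_divide_eq_right) (simp add: mult.assoc[symmetric])
qed simp

definition ln_poly :: "nat \<Rightarrow> real poly" where
  "ln_poly m = (\<Sum>i<m. monom ((- 1) ^ i / real (Suc i)) (Suc i))"

lemma poly_ln_poly: "poly (ln_poly m) y = (\<Sum>i<m. (- 1) ^ i / real (Suc i) * y ^ Suc i)"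
  by (simp add: ln_poly_def poly_sum poly_monom)

text \<open>This is \<open>ln (1 + y) - y / (1 + y) = P(y) - P(y / (1 + y))\<close> up to order 18,
  multiplied by \<open>(1 + y) ^ 17\<close> with 17 the length of \<open>harm_coeffs\<close>. The
  first omitted term of \<open>P\<close> has order 18, so it affects the difference only from order
  19 on.\<close>

lemma lowest_term_harm:
  "lowest_term 18 0
    ((ln_poly 18 - Poly harm_coeffs) * [:1, 1:] ^ 17 - [:0, 1:] * [:1, 1:] ^ 16 + subst_poly harm_coeffs)"
  by (simp add: harm_coeffs_def ln_poly_def monom_Suc monom_0 lowest_term_pCons eval_nat_numeral)

lemma harm_remainder_diff:
  "(\<lambda>n. real n ^ 18 * (ln (1 + 1 / real n) - 1 / real (Suc n)
      - (poly (Poly harm_coeffs) (1 / real n) - poly (Poly harm_coeffs) (1 / real (Suc n)))))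
    \<longlonglongrightarrow> 0"
proof -
  define P where "P = Poly harm_coeffs"
  obtain Q where Q: "(ln_poly 18 - P) * [:1, 1:] ^ 17 - [:0, 1:] * [:1, 1:] ^ 16
      + subst_poly harm_coeffs = monom 1 18 * Q" and Q0: "poly Q 0 = 0"
    using lowest_termE[OF lowest_term_harm] unfolding P_def by metis
  \<comment> \<open>The error splits into the Taylor remainder \<open>t\<close> of the logarithm, of
    size at most \<open>1 / n\<close> after scaling, and the polynomial part governed by
    \<open>Q\<close>.\<close>
  define t where "t = (\<lambda>n. real n ^ 18 * (ln (1 + 1 / real n) - poly (ln_poly 18) (1 / real n)))"
  have "t \<longlonglongrightarrow> 0"
  proof (rule Lim_null_comparison[OF _ lim_1_over_n])
    show "\<forall>\<^sub>F n in sequentially. norm (t n) \<le> 1 / real n"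
      using eventually_gt_at_top[of 0]
    proof eventually_elim
      case (elim n)
      have "norm (t n) \<le> real n ^ 18 * (1 / real n) ^ Suc 18"
        unfolding t_def norm_mult poly_ln_poly
        using ln_one_plus_taylor_bound[of "1 / real n" 18] by (intro mult_mono) auto
      also have "\<dots> = 1 / real n"
        using elim by (simp add: power_divide eval_nat_numeral)
      finally show ?case .
    qed
  qed
  moreover have "(\<lambda>n. poly Q (1 / real n) / (1 + 1 / real n) ^ 17) \<longlonglongrightarrow> poly Q 0 / (1 + 0) ^ 17"
    by (intro tendsto_intros lim_1_over_n) auto
  ultimately have "(\<lambda>n. t n + poly Q (1 / real n) / (1 + 1 / real n) ^ 17) \<longlonglongrightarrow> 0 + poly Q 0 / (1 + 0) ^ 17"
    by (rule tendsto_add)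
  moreover have "\<forall>\<^sub>F n in sequentially. t n + poly Q (1 / real n) / (1 + 1 / real n) ^ 17 =
      real n ^ 18 * (ln (1 + 1 / real n) - 1 / real (Suc n)
        - (poly P (1 / real n) - poly P (1 / real (Suc n))))"
    using eventually_gt_at_top[of 0]
  proof eventually_elim
    case (elim n)
    define y where "y = 1 / real n"
    have len: "length harm_coeffs = 17"
      by (simp add: harm_coeffs_def)
    have y: "y > 0" "real n = 1 / y"
      using elim by (auto simp: y_def)
    have z: "1 / real (Suc n) = y / (1 + y)"
      using elim by (simp add: y_def field_simps)
    define W where
      "W = poly (ln_poly 18) y - y / (1 + y) - (poly P y - poly P (y / (1 + y)))"
    have "(poly (ln_poly 18) y - poly P y) * (1 + y) ^ 17 - y * (1 + y) ^ 16
        + (1 + y) ^ 17 * poly P (y / (1 + y)) = y ^ 18 * poly Q y"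
      using arg_cong[OF Q, of "\<lambda>q. poly q y"] y
      by (simp add: poly_monom poly_subst_poly P_def len)
    moreover have "y * (1 + y) ^ 16 = (1 + y) ^ 17 * (y / (1 + y))"
      using y by (simp add: eval_nat_numeral)
    ultimately have "(1 + y) ^ 17 * W = y ^ 18 * poly Q y"
      unfolding W_def by (simp add: algebra_simps)
    moreover have "real n ^ 18 * y ^ 18 = 1"
      using y by (simp add: power_one_over)
    ultimately have "(1 + y) ^ 17 * (real n ^ 18 * W) = poly Q y"
      by (metis mult.assoc mult.left_commute mult_1)
    moreover have "(1 + y) ^ 17 \<noteq> 0"
      using y by simp
    ultimately have "poly Q y / (1 + y) ^ 17 = real n ^ 18 * W"
      by (metis nonzero_mult_div_cancel_left)
    then show ?case
      unfolding t_def z y_def[symmetric] W_def by (simp add: algebra_simps)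
  qed
  ultimately show ?thesis
    using Q0 unfolding P_def by (auto dest: Lim_transform_eventually)
qed

section \<open>Comparison with the continued fraction and the two limits\<close>

lemma tendsto_smaller_power_times:
  fixes f :: "nat \<Rightarrow> real"
  assumes "(\<lambda>n. real n ^ q * f n) \<longlonglongrightarrow> 0" and "p \<le> q"
  shows "(\<lambda>n. real n ^ p * f n) \<longlonglongrightarrow> 0"
proof (rule Lim_null_comparison[OF _ tendsto_rabs_zero[OF assms(1)]])
  show "\<forall>\<^sub>F n in sequentially. norm (real n ^ p * f n) \<le> \<bar>real n ^ q * f n\<bar>"
    using eventually_gt_at_top[of 0]
    by eventually_elim (use assms(2) in \<open>auto simp: abs_mult intro!: mult_right_mono power_increasing\<close>)
qed

text \<open>As \<open>D\<close> has constant term 1, \<open>P * D - N\<close> and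
  \<open>P - N / D\<close> have the same leading term. The orders involved reach 17 at
  \<open>k = 8\<close>; the coefficient of order 17, past the end of \<open>harm_coeffs\<close>, is
  correctly 0.\<close>

lemma lowest_term_MC:
  assumes "1 \<le> k" and "k \<le> 8"
  shows "case cfrac_poly (take k MC_coeffs) of
    (N, D) \<Rightarrow> lowest_term (2 * k + 1) (C k) (Poly harm_coeffs * D - N)"
proof -
  consider "k = 1" | "k = 2" | "k = 3" | "k = 4" | "k = 5" | "k = 6" | "k = 7" | "k = 8"
    using assms by linarith
  then show ?thesis
    by cases (simp_all add: MC_coeffs_def C_def harm_coeffs_def lowest_term_pCons eval_nat_numeral)
qed

theorem theorem5:
  fixes k :: nat
  assumes "1 \<le> k" and "k \<le> 8"
  shows "(\<lambda>n. real n ^ (2 * k + 2) * (E k n - E k (n + 1))) \<longlonglongrightarrow> real (2 * k + 1) * C k \<and>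
         (\<lambda>n. real n ^ (2 * k + 1) * E k n) \<longlonglongrightarrow> C k"
proof -
  define p where "p = 2 * k + 1"
  define P where "P = Poly harm_coeffs"
  obtain N D where ND: "cfrac_poly (take k MC_coeffs) = (N, D)"
    by (cases "cfrac_poly (take k MC_coeffs)")
  have D0: "poly D 0 = 1"
    using poly_snd_cfrac_poly_0[of "take k MC_coeffs"] by (simp add: ND)
  have "lowest_term p (C k) (P * D - N)"
    using lowest_term_MC[OF assms] by (simp add: ND p_def P_def)
  then obtain Q where Q: "P * D - N = monom 1 p * Q" and Q0: "poly Q 0 = C k"
    by (rule lowest_termE)
  define R where "R = (\<lambda>y. poly Q y / poly D y)"
  have R0: "R 0 = C k"
    by (simp add: R_def Q0 D0)
  have "\<exists>R'. (R has_real_derivative R') (at 0)"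
    unfolding R_def using DERIV_quotient[OF poly_DERIV poly_DERIV, of D 0 Q] by (auto simp: D0)
  then obtain R' where R': "(R has_real_derivative R') (at 0)" ..
  define r where "r = (\<lambda>n. (\<Sum>m=1..n. 1 / real m) - ln (real n) - euler_mascheroni - poly P (1 / real n))"
  define g where "g = (\<lambda>n. (1 / real n) ^ p * R (1 / real n))"
  have "\<forall>\<^sub>F n in sequentially. poly D (1 / real n) \<noteq> 0"
    using D0 by (intro eventually_poly_nonzero) simp
  with cfrac_eq_cfrac_poly[of "take k MC_coeffs"]
  have E_eq: "\<forall>\<^sub>F n in sequentially. E k n = r n + g n"
  proof eventually_elim
    case (elim n)
    have "poly P (1 / real n) * poly D (1 / real n) - poly N (1 / real n) =
        (1 / real n) ^ p * poly Q (1 / real n)"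
      using arg_cong[OF Q, of "\<lambda>q. poly q (1 / real n)"] by (simp add: poly_monom)
    then have "g n = (poly P (1 / real n) * poly D (1 / real n) - poly N (1 / real n)) / poly D (1 / real n)"
      by (simp add: g_def R_def)
    also have "\<dots> = poly P (1 / real n) - MC k n"
      using elim by (simp add: MC_def ND diff_divide_distrib)
    finally show ?case
      by (simp add: E_def r_def)
  qed
  \<comment> \<open>In the difference of \<open>r\<close> the constant cancels and the harmonic sums
    leave only \<open>- 1 / (n + 1)\<close>.\<close>
  have "(\<lambda>n. real n ^ 18 * (r n - r (Suc n))) \<longlonglongrightarrow> 0"
  proof (rule Lim_transform_eventually[OF harm_remainder_diff])
    show "\<forall>\<^sub>F n in sequentially. real n ^ 18 * (ln (1 + 1 / real n) - 1 / real (Suc n)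
        - (poly (Poly harm_coeffs) (1 / real n) - poly (Poly harm_coeffs) (1 / real (Suc n))))
      = real n ^ 18 * (r n - r (Suc n))"
      using eventually_gt_at_top[of 0]
    proof eventually_elim
      case (elim n)
      have "1 + 1 / real n = real (Suc n) / real n"
        using elim by (simp add: field_simps)
      then have "ln (1 + 1 / real n) = ln (real (Suc n)) - ln (real n)"
        using elim by (simp add: ln_div)
      then show ?case
        by (simp add: r_def P_def)
    qed
  qed
  \<comment> \<open>Here \<open>Suc p = 2 * k + 2\<close> is at most 18, with equality at
    \<open>k = 8\<close>.\<close>
  then have r: "(\<lambda>n. real n ^ Suc p * (r n - r (Suc n))) \<longlonglongrightarrow> 0"
    by (rule tendsto_smaller_power_times) (use assms in \<open>simp add: p_def\<close>)
  have "(\<lambda>n. real n ^ Suc p * (g n - g (Suc n))) \<longlonglongrightarrow> real p * C k"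
    unfolding g_def R0[symmetric] by (rule tendsto_power_times_diff_of_differentiable[OF R'])
  from tendsto_add[OF r this]
  have "(\<lambda>n. real n ^ Suc p * (r n - r (Suc n)) + real n ^ Suc p * (g n - g (Suc n)))
      \<longlonglongrightarrow> real p * C k"
    by simp
  then have diff: "(\<lambda>n. real n ^ Suc p * (E k n - E k (Suc n))) \<longlonglongrightarrow> real p * C k"
  proof (rule Lim_transform_eventually)
    have "\<forall>\<^sub>F n in sequentially. E k (Suc n) = r (Suc n) + g (Suc n)"
      using E_eq by (subst eventually_sequentially_Suc)
    with E_eq show "\<forall>\<^sub>F n in sequentially. real n ^ Suc p * (r n - r (Suc n))
        + real n ^ Suc p * (g n - g (Suc n)) = real n ^ Suc p * (E k n - E k (Suc n))"
      by eventually_elim (simp only: algebra_simps)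
  qed
  \<comment> \<open>\<open>E k\<close> tends to 0 by the definition of the Euler-Mascheroni
    constant, because \<open>P\<close> and \<open>y ^ p * R y\<close> vanish at 0.\<close>
  have "(\<lambda>n. (\<Sum>m=1..n. 1 / real m) - ln (real n)) \<longlonglongrightarrow> euler_mascheroni"
    using euler_mascheroni_LIMSEQ by (simp add: harm_def inverse_eq_divide)
  then have "(\<lambda>n. ((\<Sum>m=1..n. 1 / real m) - ln (real n)) - euler_mascheroni - poly P (1 / real n)
      + (1 / real n) ^ p * R (1 / real n)) \<longlonglongrightarrow> euler_mascheroni - euler_mascheroni - poly P 0 + 0 ^ p * R 0"
    by (intro tendsto_intros lim_1_over_n isCont_tendsto_compose[OF DERIV_isCont[OF R']])
  then have "(\<lambda>n. r n + g n) \<longlonglongrightarrow> 0"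
    by (simp add: r_def g_def p_def P_def harm_coeffs_def)
  then have "E k \<longlonglongrightarrow> 0"
    by (rule Lim_transform_eventually) (use E_eq in eventually_elim, simp)
  then have "(\<lambda>n. real n ^ p * E k n) \<longlonglongrightarrow> C k"
    by (rule tendsto_power_times_of_diff[rotated]) (use diff in \<open>auto simp: p_def\<close>)
  with diff show ?thesis
    by (simp add: p_def)
qed

end
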